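(* Let $X$ and $Y$ be Banach spaces, $U \subset X$ an open set, $f \colon U \to Y$ a (Fréchet) differentiable function in $U$, $x_0 \in U$, $R > 0$ satisfying $\bar{B}(x_0, R) \subset U$, let $(r_k)_{k \in \mathbb{N}}$ be a sequence in $X$, and let $\eta \geq 0$, $\nu\geq 0$, $K>0$ and $d>0$ be real numbers. Suppose that (a) $\|f(x_0)\|\leq \eta$, $\lambda(Df(x_0))\geq \nu$ and $\| Df(x)-Df(y) \| \leq K \| x-y \|$ for all $x,y \in \bar{B}(x_0,R)$. (b) $\| r_k \| \leq d$ for all $k \in \mathbb{N}$. (c) The polynomial $g_d(t) = \eta_d-\nu_d\, t+\frac{3K}{2}t^2$, where $\eta_d=\eta+\nu d$ and $\nu_d=\nu+Kd$, has a smallest real zero $t_d^*\leq R$ (that is, $g_d$ has a real zero and its smallest real zero $t_d^*$ satisfies $t_d^*\le R$), and moreover $d\leq \frac{\nu}{K}$. Then $\nu>0$, $0<t_d^*\leq \frac{\nu}{K}\left(1-\frac{1}{\sqrt{3}}\right)$ and moreover: (i) The function $f$ has a unique zero $x^*$ in $\bar{B}(x_0,t_d^* )$. (ii) The sequence $(x_k)_{k\in \mathbb{N}}$ starting at $x_0$ and defined by $x_{k+1} = T_f(x_k)+r_k$ for all $k\in \mathbb{N}$ is feasible for the Newton method for $f$ in $\bar{B}(x_0,t_d^* )$. (iii) $\|x^*-x_{k+1}\|\leq \frac{\sqrt{3}}{2}K\nu^{-1}\|x^*-x_k\|^2+\|r_k\|$ for all $k\in \mathbb{N}$. (iv) $\lim_{k\to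 \infty}x_k=x^*$ in case $\lim_{k\to \infty}\|r_k\|=0$. (v) $\|y-T_f(x_k)\|\leq \frac{\sqrt{3}}{\nu}\|Df(x_k)(x_k-y)-f(x_k)\|$ for all $y\in U$ and $k\in \mathbb{N}$.
   Context: $\mathbb{N}$ includes $0$. $\mathcal{L}(X,Y)$ is the Banach space of bounded linear operators from $X$ to $Y$ with the operator norm $\|G\| = \sup_{\|x\|_X\leq 1}\|G(x)\|_Y$. $\bar{B}(x_0,r)$ is the closed ball in $X$ of radius $r$ centered at $x_0$. "Differentiable" means Fréchet differentiable at every point of $U$, with derivative $Df \colon U \to \mathcal{L}(X,Y)$. Bijectivity modulus: for $F\in \mathcal{L}(X,Y)$, $\lambda(F)=\|F^{-1}\|^{-1}$ if $F$ is invertible, and $\lambda(F)=0$ otherwise. Newton operator: $T_f \colon X \to X$ is defined by $T_f(x) = x - Df(x)^{-1}f(x)$ if $x\in U$ and $Df(x)$ is invertible, and $T_f(x)=0$ otherwise. Feasibility: for $A\subset U$, a sequence $(x_k)_{k \in \mathbb{N}}$ in $X$ is feasible for the Newton method for $f$ in $A$ if $x_k \in A$ and $Df(x_k)$ is invertible for all $k \in \mathbb{N}$. *)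

theory Defs
  imports "HOL-Analysis.Analysis" "HOL-Computational_Algebra.Polynomial"
begin

text \<open>Invertibility is meant inside the bounded operators: the inverse has to be bounded too. On
  Banach spaces this is bijectivity, by the bounded inverse theorem.\<close>

definition is_inverse_blinfun ::
    "('a::real_normed_vector \<Rightarrow>\<^sub>L 'b::real_normed_vector) \<Rightarrow> ('b \<Rightarrow>\<^sub>L 'a) \<Rightarrow> bool" where
  "is_inverse_blinfun F G \<longleftrightarrow> G o\<^sub>L F = id_blinfun \<and> F o\<^sub>L G = id_blinfun"

definition invertible_blinfun ::
    "('a::real_normed_vector \<Rightarrow>\<^sub>L 'b::real_normed_vector) \<Rightarrow> bool" where
  "invertible_blinfun F \<longleftrightarrow> (\<exists>G. is_inverse_blinfun F G)"

definition inverse_blinfun ::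
    "('a::real_normed_vector \<Rightarrow>\<^sub>L 'b::real_normed_vector) \<Rightarrow> 'b \<Rightarrow>\<^sub>L 'a" where
  "inverse_blinfun F = (THE G. is_inverse_blinfun F G)"

text \<open>If both spaces are trivial, the value is \<open>inverse 0 = 0\<close>.\<close>

definition bijectivity_modulus ::
    "('a::real_normed_vector \<Rightarrow>\<^sub>L 'b::real_normed_vector) \<Rightarrow> real" where
  "bijectivity_modulus F =
     (if invertible_blinfun F then inverse (norm (inverse_blinfun F)) else 0)"

text \<open>\<open>f\<close> is a total function, but at a point of an open set \<open>U\<close> the derivative depends only on the
  values of \<open>f\<close> in \<open>U\<close>.\<close>

definition Df ::
    "('a::real_normed_vector \<Rightarrow> 'b::real_normed_vector) \<Rightarrow> 'a \<Rightarrow> 'a \<Rightarrow>\<^sub>L 'b" where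
  "Df f x = Blinfun (frechet_derivative f (at x))"

definition newton_op ::
    "'a::real_normed_vector set \<Rightarrow> ('a \<Rightarrow> 'b::real_normed_vector) \<Rightarrow> 'a \<Rightarrow> 'a" where
  "newton_op U f x =
     (if x \<in> U \<and> invertible_blinfun (Df f x)
      then x - blinfun_apply (inverse_blinfun (Df f x)) (f x) else 0)"

primrec inexact_newton ::
    "'a::real_normed_vector set \<Rightarrow> ('a \<Rightarrow> 'b::real_normed_vector) \<Rightarrow> 'a \<Rightarrow> (nat \<Rightarrow> 'a) \<Rightarrow> nat \<Rightarrow> 'a" where
  "inexact_newton U f x0 r 0 = x0"
| "inexact_newton U f x0 r (Suc k) = newton_op U f (inexact_newton U f x0 r k) + r k"

definition newton_feasible ::
    "('a::real_normed_vector \<Rightarrow> 'b::real_normed_vector) \<Rightarrow> 'a set \<Rightarrow> (nat \<Rightarrow> 'a) \<Rightarrow> bool" where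
  "newton_feasible f A x \<longleftrightarrow> (\<forall>k. x k \<in> A \<and> invertible_blinfun (Df f (x k)))"

definition majorant_poly :: "real \<Rightarrow> real \<Rightarrow> real \<Rightarrow> real \<Rightarrow> real poly" where
  "majorant_poly \<eta> \<nu> K d = [:\<eta> + \<nu> * d, - (\<nu> + K * d), 3 * K / 2:]"

definition is_smallest_zero :: "real poly \<Rightarrow> real \<Rightarrow> bool" where
  "is_smallest_zero p t \<longleftrightarrow> poly p t = 0 \<and> (\<forall>s. poly p s = 0 \<longrightarrow> t \<le> s)"

end

theory Submission
  imports Defs
begin

text \<open>
  Two estimates carry the proof. Let \<open>A = Df f x0\<close>. Since \<open>norm (A z) \<ge> \<nu> * norm z\<close> and the
  derivative is \<open>K\<close>-Lipschitz, the derivative at a point \<open>x\<close> at distance \<open>s\<close> from \<open>x0\<close> satisfies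
  \<open>norm (Df f x z) \<ge> (\<nu> - K * s) * norm z\<close>, and it stays invertible while \<open>K * s < \<nu>\<close>
  (\<open>norm_blinfun_ge_perturbed\<close>, \<open>invertible_blinfun_perturbed\<close>). The second estimate rests on the
  identity \<open>Df f x (y - T x) = f x - Df f x (x - y)\<close> for the Newton operator \<open>T\<close>: it turns a
  lower bound for \<open>Df f x\<close> into a bound for \<open>y - T x\<close>, for every \<open>y\<close> (\<open>newton_op_error\<close>).
  Up to \<open>f y\<close>, the right-hand side is the Taylor remainder at \<open>x\<close>, which is at most
  \<open>K / 2 * (norm (y - x))\<^sup>2\<close> (\<open>linearization_error_quadratic\<close>).

  This identity is used with three kinds of \<open>y\<close>. An arbitrary \<open>y\<close> gives the a posteriori bound.
  The zero of \<open>f\<close> gives the quadratic error estimate. The centre \<open>y = x0\<close> keeps the iterates in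
  the ball of radius \<open>t\<close>: the next iterate is at distance at most
  \<open>(\<eta> + K / 2 * s\<^sup>2) / (\<nu> - K * s) + d\<close> from \<open>x0\<close>, an expression that increases with
  \<open>s\<close> and equals \<open>t\<close> at \<open>s = t\<close> exactly because \<open>t\<close> is a zero of the majorant
  polynomial.

  The constant \<open>sqrt 3\<close> comes from the polynomial alone. Its smallest zero lies to the left of the
  vertex, so \<open>3 * K * t \<le> \<nu> + K * d\<close>; its discriminant is nonnegative, which together with
  \<open>K * d \<le> \<nu>\<close> forces \<open>K * d \<le> (2 - sqrt 3) * \<nu>\<close>. Hence \<open>\<nu> - K * t \<ge> \<nu> / sqrt 3\<close>, a
  lower bound for the derivative that is uniform on the ball.

  The zero itself does not come from the perturbed iteration, which need not converge. It is the
  fixed point of the simplified Newton map \<open>x \<mapsto> x - A\<inverse> (f x)\<close>, a contraction of the ball with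
  constant \<open>K * t / \<nu> < 1\<close>; this gives uniqueness as well (\<open>unique_zero_simplified_newton\<close>). If the
  perturbations tend to \<open>0\<close>, the quadratic error estimate is a linear contraction with
  perturbations, since the errors are at most the diameter \<open>2 * t\<close> and
  \<open>sqrt 3 / 2 * K / \<nu> * (2 * t) \<le> sqrt 3 - 1 < 1\<close>.
\<close>

section \<open>Bounded inverses and their perturbation\<close>

lemma is_inverse_blinfun_unique:
  assumes "is_inverse_blinfun F G" and "is_inverse_blinfun F H"
  shows "G = H"
proof (rule blinfun_eqI)
  fix y
  have "G (F (H y)) = H y" for y
    using assms(1) by (metis is_inverse_blinfun_def blinfun_apply_blinfun_compose
        blinfun_apply_id_blinfun)
  moreover have "F (H y) = y" for y
    using assms(2) by (metis is_inverse_blinfun_def blinfun_apply_blinfun_compose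
        blinfun_apply_id_blinfun)
  ultimately show "G y = H y" by metis
qed

lemma is_inverse_inverse_blinfun:
  assumes "invertible_blinfun F"
  shows "is_inverse_blinfun F (inverse_blinfun F)"
proof -
  obtain G where G: "is_inverse_blinfun F G"
    using assms by (auto simp: invertible_blinfun_def)
  show ?thesis
    unfolding inverse_blinfun_def
    by (rule theI[where P = "is_inverse_blinfun F", OF G is_inverse_blinfun_unique[OF _ G]])
qed

lemma inverse_blinfun_cancel:
  assumes "invertible_blinfun F"
  shows "inverse_blinfun F (F x) = x" and "F (inverse_blinfun F y) = y"
  using is_inverse_inverse_blinfun[OF assms]
  by (metis is_inverse_blinfun_def blinfun_apply_blinfun_compose blinfun_apply_id_blinfun)+

text \<open>This is how the modulus enters all later estimates: they only need a constant \<open>c\<close> with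
  \<open>c * norm x \<le> norm (F x)\<close>, which, unlike the norm of the inverse, makes sense before invertibility
  is known and is easy to perturb.\<close>

lemma norm_blinfun_ge_bijectivity_modulus:
  assumes "invertible_blinfun F"
  shows "bijectivity_modulus F * norm x \<le> norm (F x)"
proof (cases "norm (inverse_blinfun F) = 0")
  case True
  then show ?thesis using assms by (simp add: bijectivity_modulus_def)
next
  case False
  have "norm x = norm (inverse_blinfun F (F x))"
    by (simp add: inverse_blinfun_cancel(1)[OF assms])
  also have "\<dots> \<le> norm (inverse_blinfun F) * norm (F x)"
    by (rule norm_blinfun)
  finally show ?thesis
    using False assms
    by (simp add: bijectivity_modulus_def divide_simps mult.commute)
qed

text \<open>The lower bound gives injectivity and, at the same time, the continuity of the inverse, with
  norm at most \<open>1 / c\<close>.\<close>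

lemma invertible_blinfunI:
  fixes F :: "'a::real_normed_vector \<Rightarrow>\<^sub>L 'b::real_normed_vector"
  assumes "c > 0" and lower: "\<And>x. c * norm x \<le> norm (F x)" and surj: "surj F"
  shows "invertible_blinfun F"
proof -
  have inj: "inj F"
  proof (rule injI)
    fix x y assume "F x = F y"
    then have "c * norm (x - y) \<le> 0"
      using lower[of "x - y"] by (simp add: blinfun.diff_right)
    then show "x = y" using \<open>c > 0\<close> by (simp add: mult_le_0_iff)
  qed
  define G where "G = inv F"
  have FG: "F (G y) = y" for y using surj by (simp add: G_def surj_f_inv_f)
  have GF: "G (F x) = x" for x using inj by (simp add: G_def)
  have "bounded_linear G"
  proof (rule bounded_linear_intro)
    show "G (y + z) = G y + G z" for y z
      by (metis FG GF blinfun.add_right)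
    show "G (a *\<^sub>R y) = a *\<^sub>R G y" for a y
      by (metis FG GF blinfun.scaleR_right)
    show "norm (G y) \<le> norm y * inverse c" for y
      using lower[of "G y"] \<open>c > 0\<close> by (simp add: FG field_simps)
  qed
  then have "blinfun_apply (Blinfun G) = G"
    by (rule bounded_linear_Blinfun_apply)
  then have "is_inverse_blinfun F (Blinfun G)"
    by (auto simp: is_inverse_blinfun_def FG GF intro!: blinfun_eqI)
  then show ?thesis by (auto simp: invertible_blinfun_def)
qed

lemma norm_blinfun_ge_perturbed:
  fixes A B :: "'a::real_normed_vector \<Rightarrow>\<^sub>L 'b::real_normed_vector"
  assumes "c * norm x \<le> norm (A x)"
  shows "(c - norm (B - A)) * norm x \<le> norm (B x)"
proof -
  have "norm ((B - A) x) \<le> norm (B - A) * norm x" by (rule norm_blinfun)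
  moreover have "norm (A x) \<le> norm (B x) + norm ((B - A) x)"
    by (simp add: blinfun.diff_left) (metis add.commute norm_minus_commute norm_triangle_sub)
  ultimately show ?thesis using assms by (simp add: algebra_simps)
qed

text \<open>The lower bound survives the perturbation by the preceding lemma, so only surjectivity is at stake.
  Solving \<open>B x = y\<close> means finding a fixed point of \<open>x \<mapsto> x - A\<inverse> (B x - y)\<close>. As \<open>A\<close> maps the
  difference of two values to \<open>(A - B) (u - v)\<close>, this map contracts by the factor
  \<open>norm (B - A) / c < 1\<close>.\<close>

lemma invertible_blinfun_perturbed:
  fixes A B :: "'a::banach \<Rightarrow>\<^sub>L 'b::real_normed_vector"
  assumes inv: "invertible_blinfun A"
    and lower: "\<And>x. c * norm x \<le> norm (A x)"
    and close: "norm (B - A) < c"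
  shows "invertible_blinfun B"
proof (rule invertible_blinfunI)
  have c: "c > 0" using close norm_ge_zero[of "B - A"] by linarith
  show "c - norm (B - A) > 0" using close by simp
  show "(c - norm (B - A)) * norm x \<le> norm (B x)" for x
    by (rule norm_blinfun_ge_perturbed[OF lower])
  let ?q = "norm (B - A) / c"
  show "surj B"
  proof (rule surjI)
    fix y
    define \<phi> where "\<phi> x = x - inverse_blinfun A (B x - y)" for x
    have lip: "dist (\<phi> u) (\<phi> v) \<le> ?q * dist u v" for u v
    proof -
      have "A (\<phi> u - \<phi> v) = (A - B) (u - v)"
        by (simp add: \<phi>_def blinfun.diff_right blinfun.diff_left inverse_blinfun_cancel[OF inv])
      then have "c * norm (\<phi> u - \<phi> v) \<le> norm (A - B) * norm (u - v)"
        using lower[of "\<phi> u - \<phi> v"] norm_blinfun[of "A - B" "u - v"] by simp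
      then show ?thesis
        using c by (simp add: dist_norm field_simps norm_minus_commute)
    qed
    have "\<exists>!x. \<phi> x = x"
      using c close lip by (intro banach_fix_type[where c = ?q]) auto
    then obtain x where "\<phi> x = x" by auto
    then have "A (inverse_blinfun A (B x - y)) = 0" by (simp add: \<phi>_def)
    then have "B x = y" by (simp add: inverse_blinfun_cancel(2)[OF inv])
    then show "B (SOME x. B x = y) = y" by (rule someI)
  qed
qed


section \<open>Remainder estimates for a Lipschitz derivative\<close>

lemma has_derivative_Df:
  assumes "f differentiable (at x)"
  shows "(f has_derivative Df f x) (at x within S)"
proof -
  have "(f has_derivative frechet_derivative f (at x)) (at x)"
    using assms by (simp add: frechet_derivative_works)
  then show ?thesis
    unfolding Df_def
    by (metis bounded_linear_Blinfun_apply has_derivative_at_withinI has_derivative_bounded_linear)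
qed

text \<open>The factor \<open>1 / 2\<close> is that of Taylor's formula. Along the segment from \<open>x\<close> to \<open>y\<close>, parametrised by \<open>s \<in> [0, 1]\<close>, the derivative of the error is
  bounded by \<open>K * s * (norm (y - x))\<^sup>2\<close>, and the mean value inequality with a real comparison
  function gives the antiderivative of this bound. A constant bound for the derivative would lose the
  factor.\<close>

lemma linearization_error_quadratic:
  assumes "convex S" and diff: "\<And>x. x \<in> S \<Longrightarrow> f differentiable (at x)"
    and lip: "\<And>x y. x \<in> S \<Longrightarrow> y \<in> S \<Longrightarrow> norm (Df f x - Df f y) \<le> K * norm (x - y)"
    and x: "x \<in> S" and y: "y \<in> S"
  shows "norm (f y - f x - Df f x (y - x)) \<le> K / 2 * (norm (y - x))\<^sup>2"
proof -
  define p where "p s = x + s *\<^sub>R (y - x)" for s :: real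
  define h where "h s = f (p s) - Df f x (p s)" for s
  define h' where "h' s = (Df f (p s) - Df f x) (y - x)" for s
  define N where "N = norm (y - x)"
  have p: "p s \<in> S" if "0 \<le> s" "s \<le> 1" for s
    using \<open>convex S\<close> x y that unfolding p_def
    by (metis (no_types, lifting) convexD_alt add_diff_eq diff_add_eq scaleR_left_diff_distrib
        scaleR_one scaleR_right_diff_distrib add.commute)
  have h: "(h has_vector_derivative h' s) (at s)" if "0 \<le> s" "s \<le> 1" for s
  proof -
    have dp: "(p has_derivative (\<lambda>u. u *\<^sub>R (y - x))) (at s)"
      unfolding p_def by (auto intro!: derivative_eq_intros)
    have "((\<lambda>s. f (p s)) has_derivative (\<lambda>u. Df f (p s) (u *\<^sub>R (y - x)))) (at s)"
      by (rule has_derivative_compose[OF dp has_derivative_Df[OF diff[OF p[OF that]]]])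
    moreover have "((\<lambda>s. Df f x (p s)) has_derivative (\<lambda>u. Df f x (u *\<^sub>R (y - x)))) (at s)"
      by (rule bounded_linear.has_derivative[OF blinfun.bounded_linear_right dp])
    ultimately have "(h has_derivative
        (\<lambda>u. Df f (p s) (u *\<^sub>R (y - x)) - Df f x (u *\<^sub>R (y - x)))) (at s)"
      unfolding h_def by (rule has_derivative_diff)
    then show ?thesis
      unfolding has_vector_derivative_def h'_def blinfun.scaleR_right blinfun.diff_left
      by (simp only: scaleR_right_diff_distrib)
  qed
  have "norm (h 1 - h 0) \<le> K / 2 * 1\<^sup>2 * N\<^sup>2 - K / 2 * 0\<^sup>2 * N\<^sup>2"
  proof (rule differentiable_bound_general)
    show "continuous_on {0..1} h"
      using h by (auto intro!: continuous_at_imp_continuous_on has_vector_derivative_continuous)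
    show "continuous_on {0..1} (\<lambda>s. K / 2 * s\<^sup>2 * N\<^sup>2)"
      by (intro continuous_intros)
    fix s :: real assume s: "0 < s" "s < 1"
    show "(h has_vector_derivative h' s) (at s)" using h s by simp
    show "((\<lambda>s. K / 2 * s\<^sup>2 * N\<^sup>2) has_vector_derivative K * s * N\<^sup>2) (at s)"
      unfolding has_real_derivative_iff_has_vector_derivative[symmetric]
      by (auto intro!: derivative_eq_intros)
    have "norm (h' s) \<le> norm (Df f (p s) - Df f x) * N"
      unfolding h'_def N_def by (rule norm_blinfun)
    also have "\<dots> \<le> K * norm (p s - x) * N"
      using lip[OF p x] s by (intro mult_right_mono) (auto simp: N_def)
    also have "\<dots> = K * s * N\<^sup>2"
      using s by (simp add: p_def N_def power2_eq_square)
    finally show "norm (h' s) \<le> K * s * N\<^sup>2" .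
  qed simp
  moreover have "h 1 - h 0 = f y - f x - Df f x (y - x)"
    by (simp add: h_def p_def blinfun.diff_right)
  ultimately show ?thesis by (simp add: N_def)
qed


section \<open>Existence and uniqueness of the zero\<close>

text \<open>Zeros of \<open>f\<close> are the fixed points of \<open>\<phi> x = x - A\<inverse> (f x)\<close> with \<open>A = Df f x0\<close>. Applying \<open>A\<close>
  to differences involving \<open>\<phi>\<close> yields linearization errors of \<open>f\<close>: with respect to \<open>x0\<close>, where the
  quadratic bound shows that the ball is mapped to itself, and between two arbitrary points, where
  \<open>norm (Df f z - A) \<le> K * t\<close> gives the contraction constant.\<close>

lemma unique_zero_simplified_newton:
  fixes f :: "'a::banach \<Rightarrow> 'b::real_normed_vector"
  assumes diff: "\<And>x. x \<in> cball x0 t \<Longrightarrow> f differentiable (at x)"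
    and lip: "\<And>x y. x \<in> cball x0 t \<Longrightarrow> y \<in> cball x0 t
      \<Longrightarrow> norm (Df f x - Df f y) \<le> K * norm (x - y)"
    and inv: "invertible_blinfun (Df f x0)"
    and lower: "\<And>x. \<nu> * norm x \<le> norm (Df f x0 x)"
    and "\<nu> > 0" and "K \<ge> 0" and "t \<ge> 0"
    and contr: "K * t < \<nu>"
    and maps: "norm (f x0) + K / 2 * t\<^sup>2 \<le> \<nu> * t"
  shows "\<exists>!x. x \<in> cball x0 t \<and> f x = 0"
proof -
  let ?A = "Df f x0" and ?B = "cball x0 t"
  define \<phi> where "\<phi> x = x - inverse_blinfun ?A (f x)" for x
  have x0: "x0 \<in> ?B" using \<open>t \<ge> 0\<close> by simp
  have A\<phi>: "?A (\<phi> x - z) = - (f x - ?A (x - z))" for x z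
    by (simp add: \<phi>_def blinfun.diff_right inverse_blinfun_cancel(2)[OF inv])
  have fixed: "\<phi> x = x \<longleftrightarrow> f x = 0" for x
    using inverse_blinfun_cancel(2)[OF inv, of "f x"] by (auto simp: \<phi>_def)
  have "\<exists>!x. x \<in> ?B \<and> \<phi> x = x"
  proof (rule Banach_fix[where c = "K * t / \<nu>"])
    show "complete ?B" by (simp add: complete_eq_closed)
    show "?B \<noteq> {}" using x0 by blast
    show "0 \<le> K * t / \<nu>" "K * t / \<nu> < 1"
      using \<open>\<nu> > 0\<close> \<open>K \<ge> 0\<close> \<open>t \<ge> 0\<close> contr by simp_all
    show "\<phi> ` ?B \<subseteq> ?B"
    proof clarify
      fix x assume x: "x \<in> ?B"
      have "\<nu> * norm (\<phi> x - x0) \<le> norm (f x - ?A (x - x0))"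
        using lower[of "\<phi> x - x0"] by (simp add: A\<phi> norm_minus_commute)
      also have "\<dots> \<le> norm (f x0) + norm (f x - f x0 - ?A (x - x0))"
        using norm_triangle_ineq[of "f x0" "f x - f x0 - ?A (x - x0)"] by (simp add: algebra_simps)
      also have "\<dots> \<le> norm (f x0) + K / 2 * (norm (x - x0))\<^sup>2"
        using linearization_error_quadratic[OF convex_cball diff lip x0 x] by simp
      also have "\<dots> \<le> norm (f x0) + K / 2 * t\<^sup>2"
        using x \<open>K \<ge> 0\<close>
        by (intro add_left_mono mult_left_mono power_mono) (auto simp: dist_norm norm_minus_commute)
      also have "\<dots> \<le> \<nu> * t" by (rule maps)
      finally show "\<phi> x \<in> ?B"
        using \<open>\<nu> > 0\<close> by (simp add: dist_norm norm_minus_commute)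
    qed
    fix x y assume xy: "x \<in> ?B" "y \<in> ?B"
    have "norm (Df f z - ?A) \<le> K * t" if "z \<in> ?B" for z
      using order_trans[OF lip[OF that x0] mult_left_mono[of "norm (z - x0)" t K]] that \<open>K \<ge> 0\<close>
      by (simp add: dist_norm norm_minus_commute)
    then have bound: "onorm (blinfun_apply (Df f z) - blinfun_apply ?A) \<le> K * t"
      if "z \<in> ?B" for z
      using that by (simp only: norm_blinfun.rep_eq minus_blinfun.rep_eq fun_diff_def)
    have "norm (f x - f y - ?A (x - y)) \<le> norm (x - y) * (K * t)"
    proof (rule differentiable_bound_linearization[where S = ?B])
      show "y + s *\<^sub>R (x - y) \<in> ?B" if "s \<in> {0..1}" for s
        using convexD_alt[OF convex_cball, of y x0 t x s] xy that
        by (simp add: algebra_simps)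
    qed (fact has_derivative_Df[OF diff] | fact bound | fact x0)+
    moreover have "?A (\<phi> x - \<phi> y) = - (f x - f y - ?A (x - y))"
      by (simp add: \<phi>_def blinfun.diff_right inverse_blinfun_cancel(2)[OF inv])
    ultimately have "\<nu> * norm (\<phi> x - \<phi> y) \<le> norm (x - y) * (K * t)"
      using lower[of "\<phi> x - \<phi> y"] by (simp add: norm_minus_commute)
    then show "dist (\<phi> x) (\<phi> y) \<le> K * t / \<nu> * dist x y"
      using \<open>\<nu> > 0\<close> by (simp add: dist_norm field_simps)
  qed
  then show ?thesis by (simp only: fixed)
qed


section \<open>The inexact Newton iteration\<close>

text \<open>As \<open>Df f x\<close> sends \<open>x - newton_op U f x\<close> to \<open>f x\<close>, it sends \<open>y - newton_op U f x\<close> to the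
  linearization of \<open>f\<close> at \<open>x\<close> evaluated at \<open>y\<close>, whose norm appears on the right.\<close>

lemma newton_op_error:
  assumes "x \<in> U" and inv: "invertible_blinfun (Df f x)"
    and lower: "\<And>z. c * norm z \<le> norm (Df f x z)"
  shows "c * norm (y - newton_op U f x) \<le> norm (Df f x (x - y) - f x)"
proof -
  have "Df f x (y - newton_op U f x) = - (Df f x (x - y) - f x)"
    using assms(1) inv
    by (simp add: newton_op_def blinfun.diff_right blinfun.add_right inverse_blinfun_cancel)
  then show ?thesis using lower by (metis norm_minus_cancel)
qed

text \<open>Once the perturbations are below \<open>(1 - q) * (\<epsilon> / 2)\<close>, the value \<open>\<epsilon> / 2\<close> is a fixed point of the
  worst-case recursion, and the excess over it decays geometrically.\<close>

lemma perturbed_contraction_tendsto_zero: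
  fixes e \<rho> :: "nat \<Rightarrow> real"
  assumes "q \<ge> 0" and "q < 1" and "\<And>k. e k \<ge> 0"
    and step: "\<And>k. e (Suc k) \<le> q * e k + \<rho> k"
    and "\<rho> \<longlonglongrightarrow> 0"
  shows "e \<longlonglongrightarrow> 0"
proof (rule LIMSEQ_I)
  fix \<epsilon> :: real assume "\<epsilon> > 0"
  have "(1 - q) * (\<epsilon> / 2) > 0" using \<open>\<epsilon> > 0\<close> \<open>q < 1\<close> by simp
  then obtain N where N: "\<And>k. k \<ge> N \<Longrightarrow> norm (\<rho> k - 0) < (1 - q) * (\<epsilon> / 2)"
    using LIMSEQ_D[OF \<open>\<rho> \<longlonglongrightarrow> 0\<close>] by blast
  have bound: "e (N + m) \<le> q ^ m * e N + \<epsilon> / 2" for m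
  proof (induction m)
    case 0
    then show ?case using \<open>\<epsilon> > 0\<close> by simp
  next
    case (Suc m)
    have "e (N + Suc m) \<le> q * e (N + m) + (1 - q) * (\<epsilon> / 2)"
      using step[of "N + m"] N[of "N + m"] by simp
    also have "\<dots> \<le> q * (q ^ m * e N + \<epsilon> / 2) + (1 - q) * (\<epsilon> / 2)"
      using Suc.IH \<open>q \<ge> 0\<close> by (intro add_right_mono mult_left_mono)
    also have "\<dots> = q ^ Suc m * e N + \<epsilon> / 2" by (simp add: field_simps)
    finally show ?case .
  qed
  have "(\<lambda>m. q ^ m * e N) \<longlonglongrightarrow> 0"
    using \<open>q \<ge> 0\<close> \<open>q < 1\<close> by (intro tendsto_mult_left_zero LIMSEQ_realpow_zero)
  then obtain M where M: "\<And>m. m \<ge> M \<Longrightarrow> norm (q ^ m * e N - 0) < \<epsilon> / 2"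
    using LIMSEQ_D[of _ 0 "\<epsilon> / 2"] \<open>\<epsilon> > 0\<close> by fastforce
  have "norm (e k - 0) < \<epsilon>" if "k \<ge> N + M" for k
  proof -
    have "M \<le> k - N" using that by simp
    then have "q ^ (k - N) * e N < \<epsilon> / 2"
      using M[of "k - N"] unfolding real_norm_def by linarith
    then show ?thesis using bound[of "k - N"] \<open>e k \<ge> 0\<close> that by simp
  qed
  then show "\<exists>n0. \<forall>k\<ge>n0. norm (e k - 0) < \<epsilon>" by blast
qed


section \<open>The smallest zero of the majorant\<close>

text \<open>The equation for \<open>t\<close> is the vanishing of the polynomial, rearranged so that the balance used for
  the iteration is visible: \<open>(\<eta> + K / 2 * t\<^sup>2) / (\<nu> - K * t) + d = t\<close>.\<close>

lemma majorant_smallest_zero_bounds: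
  assumes "\<eta> \<ge> 0" and "\<nu> > 0" and "K > 0" and "d > 0" and "d \<le> \<nu> / K"
    and t: "is_smallest_zero (majorant_poly \<eta> \<nu> K d) t"
  shows "t > 0"
    and "t \<le> \<nu> / K * (1 - 1 / sqrt 3)"
    and "(t - d) * (\<nu> - K * t) = \<eta> + K / 2 * t\<^sup>2"
proof -
  have g: "poly (majorant_poly \<eta> \<nu> K d) s
      = \<eta> + \<nu> * d - (\<nu> + K * d) * s + 3 * K / 2 * s\<^sup>2" for s
    by (simp add: majorant_poly_def algebra_simps power2_eq_square)
  have zero: "\<eta> + \<nu> * d - (\<nu> + K * d) * t + 3 * K / 2 * t\<^sup>2 = 0"
    using t by (simp add: is_smallest_zero_def g)
  then show "(t - d) * (\<nu> - K * t) = \<eta> + K / 2 * t\<^sup>2"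
    by (simp add: algebra_simps power2_eq_square)
  show "t > 0"
  proof (rule ccontr)
    assume "\<not> t > 0"
    then have "(\<nu> + K * d) * t \<le> 0"
      using assms by (intro mult_nonneg_nonpos) auto
    moreover have "\<nu> * d > 0" "3 * K / 2 * t\<^sup>2 \<ge> 0" using assms by auto
    ultimately show False using zero \<open>\<eta> \<ge> 0\<close> by linarith
  qed
  \<comment> \<open>The reflection of \<open>t\<close> at the vertex is the other zero, so minimality puts \<open>t\<close> left of the vertex.\<close>
  let ?s = "2 * (\<nu> + K * d) / (3 * K) - t"
  have "poly (majorant_poly \<eta> \<nu> K d) ?s = 0"
  proof -
    have "poly (majorant_poly \<eta> \<nu> K d) ?s = poly (majorant_poly \<eta> \<nu> K d) t"
      unfolding g using \<open>K > 0\<close> by (simp add: field_simps power2_eq_square)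
    then show ?thesis using t by (simp add: is_smallest_zero_def)
  qed
  then have "t \<le> ?s" using t by (simp add: is_smallest_zero_def)
  then have vertex: "3 * (K * t) \<le> \<nu> + K * d"
    using \<open>K > 0\<close> by (simp add: field_simps)
  \<comment> \<open>The discriminant is a square because there is a real zero.\<close>
  have "(\<nu> + K * d)\<^sup>2 - 6 * K * (\<eta> + \<nu> * d) = (3 * K * t - (\<nu> + K * d))\<^sup>2"
    using arg_cong[OF zero, of "\<lambda>u. 6 * K * u"] by (simp add: algebra_simps power2_eq_square)
  then have "6 * K * (\<eta> + \<nu> * d) \<le> (\<nu> + K * d)\<^sup>2"
    by (metis diff_ge_0_iff_ge zero_le_power2)
  moreover have "K * \<eta> \<ge> 0" using assms by simp
  ultimately have "3 * \<nu>\<^sup>2 \<le> (2 * \<nu> - K * d)\<^sup>2"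
    by (simp add: algebra_simps power2_eq_square)
  \<comment> \<open>This selects the smaller of the two ranges left by the discriminant, where \<open>K * d\<close> is at most
    \<open>(2 - sqrt 3) * \<nu>\<close> rather than at least \<open>(2 + sqrt 3) * \<nu>\<close>.\<close>
  moreover have "K * d \<le> \<nu>" using assms by (simp add: field_simps)
  ultimately have "sqrt (3 * \<nu>\<^sup>2) \<le> 2 * \<nu> - K * d"
    using \<open>\<nu> > 0\<close> by (intro real_le_lsqrt) auto
  then have "sqrt 3 * \<nu> \<le> 2 * \<nu> - K * d"
    using \<open>\<nu> > 0\<close> by (simp add: real_sqrt_mult)
  then have "3 * (K * t) \<le> 3 * \<nu> - sqrt 3 * \<nu>" using vertex by linarith
  then have "t \<le> \<nu> / K * (1 - sqrt 3 / 3)"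
    using \<open>K > 0\<close> by (simp add: field_simps)
  moreover have "sqrt 3 / 3 = 1 / sqrt (3::real)" by (simp add: field_simps)
  ultimately show "t \<le> \<nu> / K * (1 - 1 / sqrt 3)" by simp
qed

theorem theorem3:
  fixes U :: "'a::banach set" and f :: "'a \<Rightarrow> 'b::banach"
    and x0 :: 'a and r :: "nat \<Rightarrow> 'a"
    and R \<eta> \<nu> K d t :: real
  assumes "open U"
    and "\<forall>x\<in>U. f differentiable (at x)"
    and "x0 \<in> U" and "R > 0" and "cball x0 R \<subseteq> U"
    and "\<eta> \<ge> 0" and "\<nu> \<ge> 0" and "K > 0" and "d > 0"
    and "norm (f x0) \<le> \<eta>"
    and "bijectivity_modulus (Df f x0) \<ge> \<nu>"
    and "\<forall>x\<in>cball x0 R. \<forall>y\<in>cball x0 R. norm (Df f x - Df f y) \<le> K * norm (x - y)"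
    and "\<forall>k. norm (r k) \<le> d"
    and "is_smallest_zero (majorant_poly \<eta> \<nu> K d) t" and "t \<le> R"
    and "d \<le> \<nu> / K"
  shows "\<nu> > 0 \<and> 0 < t \<and> t \<le> \<nu> / K * (1 - 1 / sqrt 3) \<and>
    (\<exists>!x. x \<in> cball x0 t \<and> f x = 0) \<and>
    (\<forall>xs. xs \<in> cball x0 t \<and> f xs = 0 \<longrightarrow>
      (let x = inexact_newton U f x0 r in
        newton_feasible f (cball x0 t) x \<and>
        (\<forall>k. norm (xs - x (Suc k)) \<le> sqrt 3 / 2 * K * inverse \<nu> * (norm (xs - x k))\<^sup>2 + norm (r k)) \<and>
        ((\<lambda>k. norm (r k)) \<longlonglongrightarrow> 0 \<longrightarrow> x \<longlonglongrightarrow> xs) \<and>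
        (\<forall>y\<in>U. \<forall>k. norm (y - newton_op U f (x k))
           \<le> sqrt 3 / \<nu> * norm (blinfun_apply (Df f (x k)) (x k - y) - f (x k)))))"
proof -
  let ?B = "cball x0 t" and ?x = "inexact_newton U f x0 r"
  have "0 < \<nu> / K" using \<open>d > 0\<close> \<open>d \<le> \<nu> / K\<close> by linarith
  then have \<nu>: "\<nu> > 0" using \<open>K > 0\<close> by (simp add: zero_less_divide_iff)
  note bounds = majorant_smallest_zero_bounds[OF \<open>\<eta> \<ge> 0\<close> \<nu> \<open>K > 0\<close> \<open>d > 0\<close> \<open>d \<le> \<nu> / K\<close>
      \<open>is_smallest_zero (majorant_poly \<eta> \<nu> K d) t\<close>]
  note t = bounds(1,2) and t_eq = bounds(3)
  have slope: "\<nu> / sqrt 3 \<le> \<nu> - K * t"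
    using t(2) \<open>K > 0\<close> by (simp add: field_simps)
  have slope_pos: "\<nu> - K * t > 0"
    using slope \<nu> by (smt (verit) divide_pos_pos real_sqrt_gt_zero)
  \<comment> \<open>The two factors on the left of the equation for \<open>t\<close> have a positive product, hence the same sign.\<close>
  have d_le_t: "d \<le> t"
  proof -
    have "0 < (t - d) * (\<nu> - K * t)"
      unfolding t_eq using \<open>\<eta> \<ge> 0\<close> \<open>K > 0\<close> t(1) by (simp add: add_nonneg_pos)
    then show ?thesis using slope_pos by (simp add: zero_less_mult_iff)
  qed
  have BR: "?B \<subseteq> cball x0 R" using \<open>t \<le> R\<close> by (rule subset_cball)
  have BU: "?B \<subseteq> U" using BR \<open>cball x0 R \<subseteq> U\<close> by blast
  have x0: "x0 \<in> ?B" using t(1) by simp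
  have diff: "f differentiable (at x)" if "x \<in> ?B" for x
    using that BU \<open>\<forall>x\<in>U. f differentiable (at x)\<close> by blast
  have lip: "norm (Df f x - Df f y) \<le> K * norm (x - y)" if "x \<in> ?B" "y \<in> ?B" for x y
    using that BR assms(12) by blast
  have inv0: "invertible_blinfun (Df f x0)"
    using \<open>bijectivity_modulus (Df f x0) \<ge> \<nu>\<close> \<nu>
    by (auto simp: bijectivity_modulus_def split: if_splits)
  have lower0: "\<nu> * norm z \<le> norm (Df f x0 z)" for z
    using norm_blinfun_ge_bijectivity_modulus[OF inv0, of z]
      mult_right_mono[OF \<open>bijectivity_modulus (Df f x0) \<ge> \<nu>\<close> norm_ge_zero[of z]] by linarith

  have near: "norm (Df f x - Df f x0) \<le> K * norm (x - x0)" "K * norm (x - x0) \<le> K * t"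
    if "x \<in> ?B" for x
    using lip[OF that x0] that \<open>K > 0\<close> by (simp_all add: dist_norm norm_minus_commute)
  have inv: "invertible_blinfun (Df f x)" if "x \<in> ?B" for x
    using invertible_blinfun_perturbed[OF inv0 lower0, of "Df f x"] near[OF that] slope_pos
    by linarith
  have lower: "(\<nu> - K * norm (x - x0)) * norm z \<le> norm (Df f x z)" if "x \<in> ?B" for x z
    using norm_blinfun_ge_perturbed[OF lower0, of "Df f x" z] near(1)[OF that]
      mult_right_mono[of "\<nu> - K * norm (x - x0)" "\<nu> - norm (Df f x - Df f x0)" "norm z"]
    by simp
  have lower': "\<nu> / sqrt 3 * norm z \<le> norm (Df f x z)" if "x \<in> ?B" for x z
  proof -
    have "\<nu> / sqrt 3 \<le> \<nu> - K * norm (x - x0)" using near(2)[OF that] slope by linarith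
    from mult_right_mono[OF this norm_ge_zero[of z]] lower[OF that, of z]
    show ?thesis by (rule order_trans)
  qed
  have error: "norm (y - newton_op U f x) \<le> sqrt 3 / \<nu> * norm (Df f x (x - y) - f x)"
    if "x \<in> ?B" for x y
  proof -
    have "\<nu> / sqrt 3 * norm (y - newton_op U f x) \<le> norm (Df f x (x - y) - f x)"
      using that BU by (intro newton_op_error inv lower') auto
    then show ?thesis using \<nu> by (simp add: field_simps)
  qed
  have remainder: "norm (Df f x (x - y) - f x) \<le> norm (f y) + K / 2 * (norm (y - x))\<^sup>2"
    if "x \<in> ?B" "y \<in> ?B" for x y
  proof -
    have "Df f x (x - y) - f x = (f y - f x - Df f x (y - x)) - f y"
      by (simp add: blinfun.diff_right)
    then have "norm (Df f x (x - y) - f x) \<le> norm (f y - f x - Df f x (y - x)) + norm (f y)"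
      by (simp only: norm_triangle_ineq4)
    also have "norm (f y - f x - Df f x (y - x)) \<le> K / 2 * (norm (y - x))\<^sup>2"
      by (rule linearization_error_quadratic[OF convex_cball diff lip that])
    finally show ?thesis by simp
  qed

  have unique: "\<exists>!x. x \<in> ?B \<and> f x = 0"
  proof (rule unique_zero_simplified_newton[OF diff lip inv0 lower0 \<nu>])
    have "norm (f x0) + K / 2 * t\<^sup>2 \<le> (t - d) * (\<nu> - K * t)"
      unfolding t_eq using \<open>norm (f x0) \<le> \<eta>\<close> by simp
    also have "\<dots> \<le> t * \<nu>"
      using d_le_t \<open>d > 0\<close> slope_pos \<open>K > 0\<close> t(1) \<nu> by (intro mult_mono) auto
    finally show "norm (f x0) + K / 2 * t\<^sup>2 \<le> \<nu> * t" by (simp add: mult.commute)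
  qed (use \<open>K > 0\<close> t(1) slope_pos in auto)

  have step: "newton_op U f x + v \<in> ?B" if x: "x \<in> ?B" and v: "norm v \<le> d" for x v
  proof -
    \<comment> \<open>The distance from \<open>x0\<close> requires the lower bound at the actual distance \<open>?s\<close>; its uniform version
      \<open>\<nu> / sqrt 3\<close> would lose the exact balance at \<open>t\<close>.\<close>
    let ?s = "norm (x - x0)" and ?n = "norm (x0 - newton_op U f x)"
    have s: "?s \<le> t" using x by (simp add: dist_norm norm_minus_commute)
    have "(\<nu> - K * ?s) * ?n \<le> norm (f x0) + K / 2 * (norm (x0 - x))\<^sup>2"
      using newton_op_error[OF _ inv[OF x] lower[OF x], where U = U and y = x0]
        remainder[OF x x0] x BU by fastforce
    also have "\<dots> \<le> \<eta> + K / 2 * t\<^sup>2"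
      using s \<open>norm (f x0) \<le> \<eta>\<close> \<open>K > 0\<close>
      by (intro add_mono mult_left_mono power_mono) (auto simp: norm_minus_commute)
    also have "\<dots> = (t - d) * (\<nu> - K * t)" by (rule t_eq[symmetric])
    also have "\<dots> \<le> (t - d) * (\<nu> - K * ?s)"
      using d_le_t near(2)[OF x] by (intro mult_left_mono) auto
    finally have "?n \<le> t - d"
      using slope_pos near(2)[OF x] by (simp add: mult.commute)
    then show ?thesis
      using v norm_triangle_ineq4[of "x0 - newton_op U f x" v]
      by (simp add: dist_norm algebra_simps)
  qed
  have ball: "?x k \<in> ?B" for k
    by (induction k) (use x0 step \<open>\<forall>k. norm (r k) \<le> d\<close> in auto)

  have main: "newton_feasible f ?B ?x \<and>
        (\<forall>k. norm (xs - ?x (Suc k)) \<le> sqrt 3 / 2 * K * inverse \<nu> * (norm (xs - ?x k))\<^sup>2 + norm (r k)) \<and>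
        ((\<lambda>k. norm (r k)) \<longlonglongrightarrow> 0 \<longrightarrow> ?x \<longlonglongrightarrow> xs) \<and>
        (\<forall>y\<in>U. \<forall>k. norm (y - newton_op U f (?x k))
           \<le> sqrt 3 / \<nu> * norm (Df f (?x k) (?x k - y) - f (?x k)))"
    if xs: "xs \<in> ?B" "f xs = 0" for xs
  proof (intro conjI allI ballI impI)
    show "newton_feasible f ?B ?x" using ball inv by (simp add: newton_feasible_def)
    show "norm (y - newton_op U f (?x k))
        \<le> sqrt 3 / \<nu> * norm (Df f (?x k) (?x k - y) - f (?x k))" for y k
      by (rule error[OF ball])
    show quad: "norm (xs - ?x (Suc k))
        \<le> sqrt 3 / 2 * K * inverse \<nu> * (norm (xs - ?x k))\<^sup>2 + norm (r k)" for k
    proof -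
      have "norm (xs - newton_op U f (?x k)) \<le> sqrt 3 / \<nu> * (K / 2 * (norm (xs - ?x k))\<^sup>2)"
        using error[OF ball, of xs k] remainder[OF ball xs(1), of k] xs(2) \<nu>
          mult_left_mono[of "norm (Df f (?x k) (?x k - xs) - f (?x k))"
            "K / 2 * (norm (xs - ?x k))\<^sup>2" "sqrt 3 / \<nu>"] by simp
      then show ?thesis
        using norm_triangle_ineq4[of "xs - newton_op U f (?x k)" "r k"]
        by (simp add: field_simps)
    qed
    assume r0: "(\<lambda>k. norm (r k)) \<longlonglongrightarrow> 0"
    have "(\<lambda>k. norm (xs - ?x k)) \<longlonglongrightarrow> 0"
    proof (rule perturbed_contraction_tendsto_zero[OF _ _ _ _ r0])
      have "sqrt 3 < sqrt (2\<^sup>2)" by (intro real_sqrt_less_mono) simp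
      then show "sqrt 3 - 1 < 1" by simp
      show "sqrt 3 - 1 \<ge> 0" by simp
      fix k
      let ?e = "norm (xs - ?x k)"
      have "?e \<le> 2 * t"
        using norm_triangle_ineq4[of "xs - x0" "?x k - x0"] xs(1) ball[of k]
        by (simp add: dist_norm norm_minus_commute)
      then have "sqrt 3 / 2 * K * inverse \<nu> * ?e \<le> sqrt 3 / 2 * K * inverse \<nu> * (2 * t)"
        using \<open>K > 0\<close> \<nu> by (intro mult_left_mono) auto
      also have "\<dots> = sqrt 3 * (K * t) / \<nu>" by (simp add: field_simps)
      also have "\<dots> \<le> sqrt 3 * (\<nu> - \<nu> / sqrt 3) / \<nu>"
        using slope \<nu> by (intro divide_right_mono mult_left_mono) auto
      also have "\<dots> = sqrt 3 - 1" using \<nu> by (simp add: field_simps)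
      finally have "sqrt 3 / 2 * K * inverse \<nu> * ?e * ?e \<le> (sqrt 3 - 1) * ?e"
        by (rule mult_right_mono) simp
      then show "norm (xs - ?x (Suc k)) \<le> (sqrt 3 - 1) * ?e + norm (r k)"
        using quad[of k] by (simp add: power2_eq_square mult.assoc)
    qed simp
    then show "?x \<longlonglongrightarrow> xs"
      unfolding tendsto_dist_iff[of ?x xs] dist_norm by (simp only: norm_minus_commute)
  qed
  show ?thesis
    unfolding Let_def using \<nu> t unique main by blast
qed

end
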